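(* Let $T$ and $T'$ be successive Hydras in an arbitrary battle (i.e. $T'$ is obtained from $T$ by a battle step at some stage), and let $H,H'\in\mathcal{T}_{\mathcal{H}}$ be encodings of $T$ and $T'$. Then there is a ground term $n$ over $\{\mathsf{0},\mathsf{s}\}$ such that $\mathsf{A}(n,H)\to^{+}_{\mathcal{H}/\mathrm{AC}}\mathsf{A}(\mathsf{s}(n),H')$.
   Context: Terms are built from variables and the function symbols: constants $\mathsf{h},\mathsf{0}$; unary $\mathsf{I},\mathsf{E},\mathsf{s}$; binary $\mathsf{A},\mathsf{B},\mathsf{C},\mathsf{D}$ and binary $\mid$ written infix. $=_{\mathrm{AC}}$ is the congruence generated by associativity and commutativity of $\mid$. For a set $\mathcal{R}$ of rules, $\to_{\mathcal{R}}$ is its closure under substitutions and contexts and $\to_{\mathcal{R}/\mathrm{AC}}={=_{\mathrm{AC}}}\cdot{\to_{\mathcal{R}}}\cdot{=_{\mathrm{AC}}}$; $\to^+$ denotes the transitive closure. The TRS $\mathcal{H}$ consists of the rules: (1) $\mathsf{A}(n,\mathsf{I}(\mathsf{h}))\to\mathsf{A}(\mathsf{s}(n),\mathsf{h})$; (2) $\mathsf{A}(n,\mathsf{I}(\mathsf{h}\mid x))\to\mathsf{A}(\mathsf{s}(n),\mathsf{I}(x))$; (3) $\mathsf{A}(n,\mathsf{I}(x))\to\mathsf{B}(n,\mathsf{D}(\mathsf{s}(n),\mathsf{I}(x)))$; (4) $\mathsf{C}(\mathsf{0},x)\to\mathsf{E}(x)$; (5) $\mathsf{C}(\mathsf{s}(n),x)\to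 x\mid\mathsf{C}(n,x)$; (6) $\mathsf{I}(\mathsf{E}(x)\mid y)\to\mathsf{E}(\mathsf{I}(x\mid y))$; (7) $\mathsf{I}(\mathsf{E}(x))\to\mathsf{E}(\mathsf{I}(x))$; (8) $\mathsf{D}(n,\mathsf{I}(\mathsf{I}(x)))\to\mathsf{I}(\mathsf{D}(n,\mathsf{I}(x)))$; (9) $\mathsf{D}(n,\mathsf{I}(\mathsf{I}(x)\mid y))\to\mathsf{I}(\mathsf{D}(n,\mathsf{I}(x))\mid y)$; (10) $\mathsf{D}(n,\mathsf{I}(\mathsf{I}(\mathsf{h}\mid x)\mid y))\to\mathsf{I}(\mathsf{C}(n,\mathsf{I}(x))\mid y)$; (11) $\mathsf{D}(n,\mathsf{I}(\mathsf{I}(\mathsf{h}\mid x)))\to\mathsf{I}(\mathsf{C}(n,\mathsf{I}(x)))$; (12) $\mathsf{D}(n,\mathsf{I}(\mathsf{I}(\mathsf{h})\mid y))\to\mathsf{I}(\mathsf{C}(n,\mathsf{h})\mid y)$; (13) $\mathsf{D}(n,\mathsf{I}(\mathsf{I}(\mathsf{h})))\to\mathsf{I}(\mathsf{C}(n,\mathsf{h}))$; (14) $\mathsf{B}(n,\mathsf{E}(x))\to\mathsf{A}(\mathsf{s}(n),x)$. $\mathcal{T}_{\mathcal{H}}$ is the set of ground terms over $\{\mathsf{h},\mathsf{I},\mid\}$. A Hydra is a finite rooted unordered tree; its heads are its leaves other than the root. An encoding of a Hydra is defined recursively: a single node is encoded as $\mathsf{h}$, and a node whose subtrees are $T_1,\dots,T_k$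 ($k\ge 1$) is encoded as $\mathsf{I}(t_1\mid\cdots\mid t_k)$ with $t_i$ an encoding of $T_i$ (encodings are unique up to $=_{\mathrm{AC}}$). A battle step at stage $n\in\mathbb{N}$ transforms a Hydra $T$ with at least one head into $T'$: choose any head $\ell$, with parent $p$, and delete $\ell$; if $p$ is the root, the result is $T'$; otherwise, let $g$ be the parent of $p$ and $P$ the subtree rooted at $p$ after the deletion, and obtain $T'$ by replacing $P$, as a child subtree of $g$, by $n+2$ copies of $P$. A battle is a sequence $T_0,T_1,\dots$ of Hydras in which $T_{n+1}$ is obtained from $T_n$ by a battle step at stage $n$ (heads being chosen by an arbitrary strategy); $T_n$ and $T_{n+1}$ are called successive Hydras (at stages $n$ and $n+1$). *)

theory Defs
  imports Main "HOL-Library.Multiset"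
begin

text \<open>Function symbols are grouped by arity, so that every element of the datatype of terms
  respects the signature.\<close>

datatype csym = c_h | c_0
datatype usym = u_I | u_E | u_s
datatype bsym = b_A | b_B | b_C | b_D | b_par

datatype trm =
    Var nat
  | Const csym
  | Unary usym trm
  | Binary bsym trm trm

abbreviation hh :: trm where "hh \<equiv> Const c_h"
abbreviation ZZ :: trm where "ZZ \<equiv> Const c_0"
abbreviation II :: "trm \<Rightarrow> trm" where "II \<equiv> Unary u_I"
abbreviation EE :: "trm \<Rightarrow> trm" where "EE \<equiv> Unary u_E"
abbreviation ss :: "trm \<Rightarrow> trm" where "ss \<equiv> Unary u_s"
abbreviation AA :: "trm \<Rightarrow> trm \<Rightarrow> trm" where "AA \<equiv> Binary b_A"
abbreviation BB :: "trm \<Rightarrow> trm \<Rightarrow> trm" where "BB \<equiv> Binary b_B"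
abbreviation CC :: "trm \<Rightarrow> trm \<Rightarrow> trm" where "CC \<equiv> Binary b_C"
abbreviation DD :: "trm \<Rightarrow> trm \<Rightarrow> trm" where "DD \<equiv> Binary b_D"
abbreviation Par :: "trm \<Rightarrow> trm \<Rightarrow> trm" (infixr "\<parallel>" 65) where "Par \<equiv> Binary b_par"

primrec subst :: "(nat \<Rightarrow> trm) \<Rightarrow> trm \<Rightarrow> trm" where
  "subst \<sigma> (Var x) = \<sigma> x"
| "subst \<sigma> (Const c) = Const c"
| "subst \<sigma> (Unary f t) = Unary f (subst \<sigma> t)"
| "subst \<sigma> (Binary f t u) = Binary f (subst \<sigma> t) (subst \<sigma> u)"

datatype ctxt =
    Hole
  | UnC usym ctxt
  | BinL bsym ctxt trm
  | BinR bsym trm ctxt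

primrec fill :: "ctxt \<Rightarrow> trm \<Rightarrow> trm" where
  "fill Hole t = t"
| "fill (UnC f C) t = Unary f (fill C t)"
| "fill (BinL f C u) t = Binary f (fill C t) u"
| "fill (BinR f u C) t = Binary f u (fill C t)"

inductive_set rstep :: "(trm \<times> trm) set \<Rightarrow> (trm \<times> trm) set" for R where
  "(l, r) \<in> R \<Longrightarrow> (fill C (subst \<sigma> l), fill C (subst \<sigma> r)) \<in> rstep R"

inductive_set ac_eq :: "(trm \<times> trm) set" where
  assoc: "((t \<parallel> u) \<parallel> v, t \<parallel> (u \<parallel> v)) \<in> ac_eq"
| comm: "(t \<parallel> u, u \<parallel> t) \<in> ac_eq"
| refl: "(t, t) \<in> ac_eq"
| sym: "(t, u) \<in> ac_eq \<Longrightarrow> (u, t) \<in> ac_eq"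
| trans: "(t, u) \<in> ac_eq \<Longrightarrow> (u, v) \<in> ac_eq \<Longrightarrow> (t, v) \<in> ac_eq"
| cong_Unary: "(t, t') \<in> ac_eq \<Longrightarrow> (Unary f t, Unary f t') \<in> ac_eq"
| cong_Binary: "(t, t') \<in> ac_eq \<Longrightarrow> (u, u') \<in> ac_eq \<Longrightarrow> (Binary f t u, Binary f t' u') \<in> ac_eq"

definition rstep_AC :: "(trm \<times> trm) set \<Rightarrow> (trm \<times> trm) set" where
  "rstep_AC R = ac_eq O rstep R O ac_eq"

abbreviation "vn \<equiv> Var 0"
abbreviation "vx \<equiv> Var 1"
abbreviation "vy \<equiv> Var 2"

definition TRS_H :: "(trm \<times> trm) set" where
  "TRS_H = {
    (AA vn (II hh),                     AA (ss vn) hh),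
    (AA vn (II (hh \<parallel> vx)),              AA (ss vn) (II vx)),
    (AA vn (II vx),                     BB vn (DD (ss vn) (II vx))),
    (CC ZZ vx,                          EE vx),
    (CC (ss vn) vx,                     vx \<parallel> CC vn vx),
    (II (EE vx \<parallel> vy),                   EE (II (vx \<parallel> vy))),
    (II (EE vx),                        EE (II vx)),
    (DD vn (II (II vx)),                II (DD vn (II vx))),
    (DD vn (II (II vx \<parallel> vy)),           II (DD vn (II vx) \<parallel> vy)),
    (DD vn (II (II (hh \<parallel> vx) \<parallel> vy)),    II (CC vn (II vx) \<parallel> vy)),
    (DD vn (II (II (hh \<parallel> vx))),         II (CC vn (II vx))),
    (DD vn (II (II hh \<parallel> vy)),           II (CC vn hh \<parallel> vy)),
    (DD vn (II (II hh)),                II (CC vn hh)),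
    (BB vn (EE vx),                     AA (ss vn) vx)}"

text \<open>The ground terms over \<open>{h, I, |}\<close> and over \<open>{0, s}\<close>, respectively.\<close>

inductive_set hydra_terms :: "trm set" where
  "hh \<in> hydra_terms"
| "t \<in> hydra_terms \<Longrightarrow> II t \<in> hydra_terms"
| "t \<in> hydra_terms \<Longrightarrow> u \<in> hydra_terms \<Longrightarrow> t \<parallel> u \<in> hydra_terms"

inductive_set numerals :: "trm set" where
  "ZZ \<in> numerals"
| "t \<in> numerals \<Longrightarrow> ss t \<in> numerals"

text \<open>Finite rooted unordered trees; a node is given by the multiset of its child subtrees.\<close>

datatype hydra = Node "hydra multiset"

text \<open>\<open>par_of ts t\<close>: \<open>t\<close> arises from \<open>t\<^sub>1 | \<dots> | t\<^sub>k\<close> by some choice of parentheses.\<close>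

inductive par_of :: "trm list \<Rightarrow> trm \<Rightarrow> bool" where
  "par_of [t] t"
| "par_of ts t \<Longrightarrow> par_of us u \<Longrightarrow> par_of (ts @ us) (t \<parallel> u)"

text \<open>The relation admits every enumeration of the subtrees and every parenthesization,
  so that a Hydra has all members of one AC-equivalence class as encodings.\<close>

inductive encodes :: "hydra \<Rightarrow> trm \<Rightarrow> bool" where
  "encodes (Node {#}) hh"
| "Ts \<noteq> [] \<Longrightarrow> list_all2 encodes Ts ts \<Longrightarrow> par_of ts t \<Longrightarrow> encodes (Node (mset Ts)) (II t)"

text \<open>Chopping off a head whose parent \<open>p\<close> is not the root. In the first rule the root of
  the given tree is the parent \<open>g\<close> of \<open>p\<close>, and \<open>Node P\<close> is the subtree at \<open>p\<close> after the
  deletion; in the second rule \<open>g\<close> lies within the child subtree \<open>S\<close>.\<close>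

inductive inner_step :: "nat \<Rightarrow> hydra \<Rightarrow> hydra \<Rightarrow> bool" for n where
  "inner_step n (Node (add_mset (Node (add_mset (Node {#}) P)) Q))
                (Node (replicate_mset (n + 2) (Node P) + Q))"
| "inner_step n S S' \<Longrightarrow> inner_step n (Node (add_mset S Q)) (Node (add_mset S' Q))"

inductive battle_step :: "nat \<Rightarrow> hydra \<Rightarrow> hydra \<Rightarrow> bool" for n where
  root: "battle_step n (Node (add_mset (Node {#}) P)) (Node P)"
| inner: "inner_step n T T' \<Longrightarrow> battle_step n T T'"

end

(* Encodings of a Hydra exist and are unique up to AC, so it suffices to simulate a battle step
   on one well-chosen encoding of each side. A head below the root is removed by rules (1) and (2).
   Otherwise rule (3) starts a D with counter stage + 1; it walks down from the root to the
   grandparent of the head (rules (8), (9)), removes the head (rules (10)-(13)), and the resulting C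
   produces stage + 1 copies followed by one more copy marked with E. That E bubbles up to the root
   (rules (6), (7)), where rule (14) increments the stage. *)
theory Submission
  imports Defs
begin

section \<open>AC equivalence and nonempty rewrite sequences modulo AC\<close>

definition ac_equiv :: "trm \<Rightarrow> trm \<Rightarrow> bool" (infix "\<approx>" 50) where
  "s \<approx> t \<longleftrightarrow> (s, t) \<in> ac_eq"

definition reduces :: "trm \<Rightarrow> trm \<Rightarrow> bool" (infix "\<leadsto>" 50) where
  "s \<leadsto> t \<longleftrightarrow> (s, t) \<in> (rstep_AC TRS_H)\<^sup>+"

lemmas ac_assoc = ac_eq.assoc[folded ac_equiv_def]
  and ac_comm = ac_eq.comm[folded ac_equiv_def]
  and ac_refl = ac_eq.refl[folded ac_equiv_def]
  and ac_sym = ac_eq.sym[folded ac_equiv_def]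
  and ac_trans [trans] = ac_eq.trans[folded ac_equiv_def]
  and ac_Unary = ac_eq.cong_Unary[folded ac_equiv_def]
  and ac_Binary = ac_eq.cong_Binary[folded ac_equiv_def]

lemma ac_left_commute: "s \<parallel> (t \<parallel> u) \<approx> t \<parallel> (s \<parallel> u)"
  by (meson ac_assoc ac_comm ac_Binary ac_refl ac_sym ac_trans)

section \<open>Rewriting modulo AC\<close>

lemma rstep_ctxt:
  assumes "(s, t) \<in> rstep R"
  shows "(fill C s, fill C t) \<in> rstep R"
proof -
  \<comment> \<open>Contexts compose. Only the effect under \<open>fill\<close> matters, so the
    existence of a composite context suffices.\<close>
  have comp: "\<exists>E. \<forall>u. fill C (fill D u) = fill E u" for D
  proof (induction C)
    case Hole
    show ?case by auto
  next
    case (UnC f C)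
    then obtain E where "\<forall>u. fill C (fill D u) = fill E u" by blast
    then show ?case by (intro exI[of _ "UnC f E"]) simp
  next
    case (BinL f C v)
    then obtain E where "\<forall>u. fill C (fill D u) = fill E u" by blast
    then show ?case by (intro exI[of _ "BinL f E v"]) simp
  next
    case (BinR f v C)
    then obtain E where "\<forall>u. fill C (fill D u) = fill E u" by blast
    then show ?case by (intro exI[of _ "BinR f v E"]) simp
  qed
  from assms show ?thesis
  proof cases
    case (1 l r D \<sigma>)
    with comp[of D] show ?thesis by (metis rstep.intros)
  qed
qed

lemma ac_ctxt: "(s, t) \<in> ac_eq \<Longrightarrow> (fill C s, fill C t) \<in> ac_eq"
  by (induction C) (auto intro: ac_eq.intros)

lemma rstep_AC_ctxt:
  "(s, t) \<in> rstep_AC R \<Longrightarrow> (fill C s, fill C t) \<in> rstep_AC R"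
  unfolding rstep_AC_def by (blast intro: rstep_ctxt ac_ctxt)

lemma reduces_ctxt: "s \<leadsto> t \<Longrightarrow> fill C s \<leadsto> fill C t"
  unfolding reduces_def
proof (induction rule: trancl_induct)
  case (base t)
  then show ?case by (blast intro: rstep_AC_ctxt)
next
  case (step t u)
  then show ?case by (blast intro: rstep_AC_ctxt trancl_into_trancl)
qed

lemma reduces_Unary: "s \<leadsto> t \<Longrightarrow> Unary f s \<leadsto> Unary f t"
  using reduces_ctxt[of s t "UnC f Hole"] by simp

lemma reduces_BinaryL: "s \<leadsto> t \<Longrightarrow> Binary f s u \<leadsto> Binary f t u"
  using reduces_ctxt[of s t "BinL f Hole u"] by simp

lemma reduces_BinaryR: "s \<leadsto> t \<Longrightarrow> Binary f u s \<leadsto> Binary f u t"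
  using reduces_ctxt[of s t "BinR f u Hole"] by simp

lemma reduces_trans [trans]: "s \<leadsto> t \<Longrightarrow> t \<leadsto> u \<Longrightarrow> s \<leadsto> u"
  unfolding reduces_def by (rule trancl_trans)

text \<open>\<open>rstep_AC\<close> has AC steps on both sides of a rewrite step. Hence an AC step
  in front merges into the first rewrite step, which exists because \<open>reduces\<close> is a
  transitive closure without reflexivity. \<open>reduces_ac\<close> merges an AC step at the end
  into the last one.\<close>

lemma ac_reduces [trans]:
  assumes "s \<approx> t" "t \<leadsto> u"
  shows "s \<leadsto> u"
proof -
  from assms(2) obtain v where v: "(t, v) \<in> rstep_AC TRS_H" "(v, u) \<in> (rstep_AC TRS_H)\<^sup>*"
    unfolding reduces_def by (blast dest: tranclD)
  from assms(1) v(1) have "(s, v) \<in> rstep_AC TRS_H"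
    unfolding rstep_AC_def ac_equiv_def by (blast intro: ac_eq.trans)
  with v(2) show ?thesis unfolding reduces_def by (rule rtrancl_into_trancl2[rotated])
qed

lemma reduces_ac [trans]:
  assumes "s \<leadsto> t" "t \<approx> u"
  shows "s \<leadsto> u"
proof -
  from assms(1) obtain v where v: "(s, v) \<in> (rstep_AC TRS_H)\<^sup>*" "(v, t) \<in> rstep_AC TRS_H"
    unfolding reduces_def by (blast dest: tranclD2)
  from assms(2) v(2) have "(v, u) \<in> rstep_AC TRS_H"
    unfolding rstep_AC_def ac_equiv_def by (blast intro: ac_eq.trans)
  with v(1) show ?thesis unfolding reduces_def by (rule rtrancl_into_trancl1)
qed

lemma rule_instance:
  assumes "(l, r) \<in> TRS_H"
  shows "subst \<sigma> l \<leadsto> subst \<sigma> r"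
proof -
  have "(subst \<sigma> l, subst \<sigma> r) \<in> rstep TRS_H"
    using rstep.intros[OF assms, of Hole \<sigma>] by simp
  then show ?thesis unfolding reduces_def rstep_AC_def by (blast intro: ac_eq.refl)
qed

lemma TRS_H_reduces:
  "AA n (II hh) \<leadsto> AA (ss n) hh"
  "AA n (II (hh \<parallel> x)) \<leadsto> AA (ss n) (II x)"
  "AA n (II x) \<leadsto> BB n (DD (ss n) (II x))"
  "CC ZZ x \<leadsto> EE x"
  "CC (ss n) x \<leadsto> x \<parallel> CC n x"
  "II (EE x \<parallel> y) \<leadsto> EE (II (x \<parallel> y))"
  "II (EE x) \<leadsto> EE (II x)"
  "DD n (II (II x)) \<leadsto> II (DD n (II x))"
  "DD n (II (II x \<parallel> y)) \<leadsto> II (DD n (II x) \<parallel> y)"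
  "DD n (II (II (hh \<parallel> x) \<parallel> y)) \<leadsto> II (CC n (II x) \<parallel> y)"
  "DD n (II (II (hh \<parallel> x))) \<leadsto> II (CC n (II x))"
  "DD n (II (II hh \<parallel> y)) \<leadsto> II (CC n hh \<parallel> y)"
  "DD n (II (II hh)) \<leadsto> II (CC n hh)"
  "BB n (EE x) \<leadsto> AA (ss n) x"
proof -
  \<comment> \<open>All rules use variables 0, 1 and 2 only, so one substitution instantiates every
    rule; its value at other indices is arbitrary.\<close>
  define \<sigma> where "\<sigma> = (\<lambda>i::nat. if i = 0 then n else if i = 1 then x else y)"
  have inst: "subst \<sigma> l \<leadsto> subst \<sigma> r" if "(l, r) \<in> TRS_H" for l r
    using that by (rule rule_instance)
  have \<sigma>: "\<sigma> 0 = n" "\<sigma> 1 = x" "\<sigma> (Suc 0) = x" "\<sigma> 2 = y" by (simp_all add: \<sigma>_def)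
  note simps = \<sigma> TRS_H_def
  show "AA n (II hh) \<leadsto> AA (ss n) hh"
    using inst[of "AA vn (II hh)" "AA (ss vn) hh"] by (simp add: simps)
  show "AA n (II (hh \<parallel> x)) \<leadsto> AA (ss n) (II x)"
    using inst[of "AA vn (II (hh \<parallel> vx))" "AA (ss vn) (II vx)"] by (simp add: simps)
  show "AA n (II x) \<leadsto> BB n (DD (ss n) (II x))"
    using inst[of "AA vn (II vx)" "BB vn (DD (ss vn) (II vx))"] by (simp add: simps)
  show "CC ZZ x \<leadsto> EE x"
    using inst[of "CC ZZ vx" "EE vx"] by (simp add: simps)
  show "CC (ss n) x \<leadsto> x \<parallel> CC n x"
    using inst[of "CC (ss vn) vx" "vx \<parallel> CC vn vx"] by (simp add: simps)
  show "II (EE x \<parallel> y) \<leadsto> EE (II (x \<parallel> y))"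
    using inst[of "II (EE vx \<parallel> vy)" "EE (II (vx \<parallel> vy))"] by (simp add: simps)
  show "II (EE x) \<leadsto> EE (II x)"
    using inst[of "II (EE vx)" "EE (II vx)"] by (simp add: simps)
  show "DD n (II (II x)) \<leadsto> II (DD n (II x))"
    using inst[of "DD vn (II (II vx))" "II (DD vn (II vx))"] by (simp add: simps)
  show "DD n (II (II x \<parallel> y)) \<leadsto> II (DD n (II x) \<parallel> y)"
    using inst[of "DD vn (II (II vx \<parallel> vy))" "II (DD vn (II vx) \<parallel> vy)"] by (simp add: simps)
  show "DD n (II (II (hh \<parallel> x) \<parallel> y)) \<leadsto> II (CC n (II x) \<parallel> y)"
    using inst[of "DD vn (II (II (hh \<parallel> vx) \<parallel> vy))" "II (CC vn (II vx) \<parallel> vy)"]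
    by (simp add: simps)
  show "DD n (II (II (hh \<parallel> x))) \<leadsto> II (CC n (II x))"
    using inst[of "DD vn (II (II (hh \<parallel> vx)))" "II (CC vn (II vx))"] by (simp add: simps)
  show "DD n (II (II hh \<parallel> y)) \<leadsto> II (CC n hh \<parallel> y)"
    using inst[of "DD vn (II (II hh \<parallel> vy))" "II (CC vn hh \<parallel> vy)"] by (simp add: simps)
  show "DD n (II (II hh)) \<leadsto> II (CC n hh)"
    using inst[of "DD vn (II (II hh))" "II (CC vn hh)"] by (simp add: simps)
  show "BB n (EE x) \<leadsto> AA (ss n) x"
    using inst[of "BB vn (EE vx)" "AA (ss vn) vx"] by (simp add: simps)
qed

section \<open>Uniqueness of encodings up to AC\<close>

text \<open>The right-nested representative of all parenthesizations of a list. The operator has no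
  neutral element, so the empty list gets no meaningful value.\<close>

fun par_list :: "trm list \<Rightarrow> trm" where
  "par_list [] = undefined"
| "par_list [t] = t"
| "par_list (t # u # us) = t \<parallel> par_list (u # us)"

lemma par_list_Cons: "ts \<noteq> [] \<Longrightarrow> par_list (t # ts) = t \<parallel> par_list ts"
  by (cases ts) auto

lemma par_list_append:
  "ts \<noteq> [] \<Longrightarrow> us \<noteq> [] \<Longrightarrow> par_list (ts @ us) \<approx> par_list ts \<parallel> par_list us"
proof (induction ts rule: par_list.induct)
  case (2 t)
  then show ?case by (simp add: par_list_Cons ac_refl)
next
  case (3 t v vs)
  then have "par_list ((t # v # vs) @ us) \<approx> t \<parallel> (par_list (v # vs) \<parallel> par_list us)"
    by (auto intro: ac_Binary ac_refl)
  also have "\<dots> \<approx> par_list (t # v # vs) \<parallel> par_list us"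
    by (simp add: ac_sym[OF ac_assoc])
  finally show ?case .
qed simp

lemma par_of_nonempty: "par_of ts t \<Longrightarrow> ts \<noteq> []"
  by (induction rule: par_of.induct) auto

text \<open>Associativity alone turns every parenthesization into the right-nested one.\<close>

lemma par_of_par_list: "par_of ts t \<Longrightarrow> t \<approx> par_list ts"
proof (induction rule: par_of.induct)
  case (1 t)
  show ?case by (simp add: ac_refl)
next
  case (2 ts t us u)
  have "t \<parallel> u \<approx> par_list ts \<parallel> par_list us"
    using 2(3,4) by (rule ac_Binary)
  also have "\<dots> \<approx> par_list (ts @ us)"
    using 2(1,2) by (intro ac_sym[OF par_list_append] par_of_nonempty)
  finally show ?case .
qed

lemma par_list_pull:
  "t \<in> set ts \<Longrightarrow> remove1 t ts \<noteq> [] \<Longrightarrow> par_list ts \<approx> t \<parallel> par_list (remove1 t ts)"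
proof (induction ts)
  case (Cons u us)
  show ?case
  proof (cases "u = t")
    case True
    with Cons.prems show ?thesis by (simp add: par_list_Cons ac_refl)
  next
    case False
    with Cons.prems have mem: "t \<in> set us" by simp
    then have us: "us \<noteq> []" by auto
    show ?thesis
    proof (cases "remove1 t us = []")
      case True
      \<comment> \<open>Here the whole list is \<open>[u, t]\<close>, and a single use of
        commutativity suffices.\<close>
      with mem have "us = [t]" by (cases us) (auto split: if_splits)
      with False show ?thesis by (simp add: ac_comm)
    next
      case nonempty: False
      have "par_list (u # us) \<approx> u \<parallel> (t \<parallel> par_list (remove1 t us))"
        using Cons.IH[OF mem nonempty] us
        by (simp add: par_list_Cons ac_Binary ac_refl)
      also have "\<dots> \<approx> t \<parallel> (u \<parallel> par_list (remove1 t us))" by (rule ac_left_commute)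
      finally show ?thesis using False nonempty by (simp add: par_list_Cons)
    qed
  qed
qed simp

text \<open>The head of the first list also occurs in the second; pulling it to the front there
  leaves two shorter lists with equal multisets. For empty lists both sides are the same
  term.\<close>

lemma par_list_mset: "mset ts = mset us \<Longrightarrow> par_list ts \<approx> par_list us"
proof (induction ts arbitrary: us)
  case (Cons t ts)
  have mem: "t \<in> set us" using Cons.prems by (metis list.set_intros(1) set_mset_mset)
  have rest: "mset ts = mset (remove1 t us)" using Cons.prems[symmetric] by simp
  show ?case
  proof (cases "ts = []")
    case True
    then have "us = [t]" using Cons.prems by simp
    with True show ?thesis by (simp add: ac_refl)
  next
    case False
    have "remove1 t us \<noteq> []" using False rest by (metis mset_zero_iff)
    with mem have pull: "t \<parallel> par_list (remove1 t us) \<approx> par_list us"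
      by (rule ac_sym[OF par_list_pull])
    have "par_list (t # ts) \<approx> t \<parallel> par_list (remove1 t us)"
      using False Cons.IH[OF rest] by (simp add: par_list_Cons ac_Binary ac_refl)
    also note pull
    finally show ?thesis .
  qed
qed (simp add: ac_refl)

lemma par_list_cong: "list_all2 (\<approx>) ts us \<Longrightarrow> par_list ts \<approx> par_list us"
proof (induction rule: list_all2_induct)
  case (Cons t ts u us)
  show ?case
  proof (cases "ts = []")
    case True
    with Cons show ?thesis by simp
  next
    case False
    with Cons have "us \<noteq> []" by auto
    with False Cons show ?thesis by (simp add: par_list_Cons ac_Binary)
  qed
qed (simp add: ac_refl)

text \<open>Two encodings can differ in the order of the children, in the parentheses, and
  recursively inside the children. Each difference is an AC equivalence.\<close>

lemma encodes_unique: "encodes T t \<Longrightarrow> encodes T u \<Longrightarrow> t \<approx> u"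
proof (induction arbitrary: u rule: encodes.induct)
  case 1
  then show ?case by cases (auto intro: ac_refl)
next
  case (2 Ts ts t)
  from \<open>encodes (Node (mset Ts)) u\<close> show ?case
  proof cases
    case 1
    with 2 show ?thesis by simp
  next
    case (2 Us us v)
    have "list_all2 encodes Us us" "mset Ts = mset Us" using 2 by simp_all
    \<comment> \<open>Permuting the second list of subterms along with its trees makes both
      encodings enumerate the children in the same order \<open>Ts\<close>.\<close>
    then obtain us' where us': "list_all2 encodes Ts us'" "mset us' = mset us"
      using list_all2_reorder_left_invariance by metis
    \<comment> \<open>The induction hypothesis sits inside the \<open>list_all2\<close> premise on
      \<open>Ts\<close> and \<open>ts\<close>, hence the argument by position.\<close>
    have "list_all2 (\<approx>) ts us'"
      using \<open>list_all2 _ Ts ts\<close> us'(1) by (auto simp: list_all2_conv_all_nth)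
    note par_list_cong[OF this]
    have "t \<approx> par_list ts" using \<open>par_of ts t\<close> by (rule par_of_par_list)
    also note \<open>par_list ts \<approx> par_list us'\<close>
    also have "par_list us' \<approx> par_list us" using us'(2) by (rule par_list_mset)
    also have "par_list us \<approx> v" using \<open>par_of us v\<close> by (rule ac_sym[OF par_of_par_list])
    finally show ?thesis using 2 by (simp add: ac_Unary)
  qed
qed

section \<open>Encodings of forests\<close>

text \<open>This describes what stands below the \<open>II\<close> of a node: multiset union of
  children becomes \<open>Par\<close>, without any bookkeeping of lists. It fails for the empty
  forest, because \<open>par_of\<close> never holds for the empty list; hence the later case splits
  on \<open>{#}\<close>.\<close>

definition encodes_forest :: "hydra multiset \<Rightarrow> trm \<Rightarrow> bool" where
  "encodes_forest Q q \<longleftrightarrow> (\<exists>Ts ts. mset Ts = Q \<and> list_all2 encodes Ts ts \<and> par_of ts q)"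

lemma encodes_forest_single: "encodes T t \<Longrightarrow> encodes_forest {#T#} t"
  unfolding encodes_forest_def
  by (intro exI[of _ "[T]"] exI[of _ "[t]"]) (simp add: par_of.intros)

lemma encodes_forest_union:
  assumes "encodes_forest P p" "encodes_forest Q q"
  shows "encodes_forest (P + Q) (p \<parallel> q)"
proof -
  from assms obtain Ts ts Us us where
    "mset Ts = P" "list_all2 encodes Ts ts" "par_of ts p"
    "mset Us = Q" "list_all2 encodes Us us" "par_of us q"
    unfolding encodes_forest_def by blast
  then show ?thesis unfolding encodes_forest_def
    by (intro exI[of _ "Ts @ Us"] exI[of _ "ts @ us"])
      (simp add: list_all2_appendI par_of.intros(2))
qed

lemma encodes_forest_add:
  "encodes T t \<Longrightarrow> encodes_forest Q q \<Longrightarrow> encodes_forest (add_mset T Q) (t \<parallel> q)"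
  using encodes_forest_union[OF encodes_forest_single] by simp

lemma encodes_Node:
  assumes "encodes_forest Q q"
  shows "encodes (Node Q) (II q)"
proof -
  from assms obtain Ts ts where Ts: "mset Ts = Q" "list_all2 encodes Ts ts" "par_of ts q"
    unfolding encodes_forest_def by blast
  then have "Ts \<noteq> []" using par_of_nonempty by auto
  with Ts show ?thesis by (auto intro: encodes.intros(2))
qed

text \<open>Encodability of the members is a premise because the lemma is applied inside the
  structural induction of \<open>encodes_exists\<close>, where that is the induction
  hypothesis.\<close>

lemma encodes_forest_exists_aux:
  "(\<And>T. T \<in># Q \<Longrightarrow> \<exists>t. encodes T t) \<Longrightarrow> Q \<noteq> {#} \<Longrightarrow> \<exists>q. encodes_forest Q q"
proof (induction Q)
  case (add T Q)
  then obtain t where t: "encodes T t" by auto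
  show ?case
  proof (cases "Q = {#}")
    case True
    with t show ?thesis by (auto intro: encodes_forest_single)
  next
    case False
    with add obtain q where "encodes_forest Q q" by auto
    with t show ?thesis by (blast intro: encodes_forest_add)
  qed
qed simp

lemma encodes_exists: "\<exists>t. encodes T t"
proof (induction T)
  case (Node Q)
  show ?case
  proof (cases "Q = {#}")
    case True
    then show ?thesis by (auto intro: encodes.intros)
  next
    case False
    with Node encodes_forest_exists_aux[of Q] show ?thesis by (blast intro: encodes_Node)
  qed
qed

lemma encodes_forest_exists: "Q \<noteq> {#} \<Longrightarrow> \<exists>q. encodes_forest Q q"
  using encodes_forest_exists_aux encodes_exists by blast

text \<open>The cases distinguish whether the parent becomes a leaf when it loses the head. This is
  the split between rules (1) and (2), and between (12), (13) and (10), (11).\<close>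

lemma encodes_chop:
  obtains "encodes (Node (add_mset (Node {#}) P)) (II hh)" "encodes (Node P) hh"
  | x where "encodes (Node (add_mset (Node {#}) P)) (II (hh \<parallel> x))" "encodes (Node P) (II x)"
proof (cases "P = {#}")
  case True
  show ?thesis
    using that(1) encodes_Node[OF encodes_forest_single[OF encodes.intros(1)]] encodes.intros(1)
    by (simp add: True)
next
  case False
  then obtain x where "encodes_forest P x" using encodes_forest_exists by blast
  then show ?thesis
    by (intro that(2)[of x] encodes_Node encodes_forest_add encodes.intros(1))
qed

section \<open>Simulation of a battle step\<close>

primrec numeral_of :: "nat \<Rightarrow> trm" where
  "numeral_of 0 = ZZ"
| "numeral_of (Suc n) = ss (numeral_of n)"

lemma numeral_of_numerals: "numeral_of n \<in> numerals"
  by (induction n) (auto intro: numerals.intros)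

text \<open>Without a neutral element there is no term for zero copies, so \<open>copies n p\<close>
  contains \<open>p\<close> exactly \<open>n + 1\<close> times.\<close>

primrec copies :: "nat \<Rightarrow> trm \<Rightarrow> trm" where
  "copies 0 p = p"
| "copies (Suc n) p = p \<parallel> copies n p"

lemma encodes_forest_copies:
  "encodes T t \<Longrightarrow> encodes_forest (replicate_mset (Suc n) T) (copies n t)"
proof (induction n)
  case 0
  then show ?case by (simp add: encodes_forest_single)
next
  case (Suc n)
  then show ?case using encodes_forest_add by fastforce
qed

text \<open>Rule (5) splits off \<open>n + 1\<close> plain copies, and rule (4) marks one further
  copy, so \<open>n + 2\<close> arise in all. The marked copy is moved to the front, where rule (6)
  expects it.\<close>

lemma CC_reduces: "CC (numeral_of (Suc n)) p \<leadsto> EE p \<parallel> copies n p"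
proof (induction n)
  case 0
  have "CC (numeral_of (Suc 0)) p \<leadsto> p \<parallel> CC ZZ p" by (simp add: TRS_H_reduces)
  also have "\<dots> \<leadsto> p \<parallel> EE p" by (rule reduces_BinaryR) (rule TRS_H_reduces)
  also have "\<dots> \<approx> EE p \<parallel> p" by (rule ac_comm)
  finally show ?case by simp
next
  case (Suc n)
  have "CC (numeral_of (Suc (Suc n))) p \<leadsto> p \<parallel> CC (numeral_of (Suc n)) p"
    by (simp add: TRS_H_reduces)
  also have "\<dots> \<leadsto> p \<parallel> (EE p \<parallel> copies n p)" by (rule reduces_BinaryR) (rule Suc)
  also have "\<dots> \<approx> EE p \<parallel> (p \<parallel> copies n p)" by (rule ac_left_commute)
  finally show ?case by simp
qed

lemma II_CC_reduces: "II (CC (numeral_of (Suc n)) p) \<leadsto> EE (II (p \<parallel> copies n p))"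
  by (rule reduces_trans[OF reduces_Unary[OF CC_reduces]]) (rule TRS_H_reduces)

lemma II_CC_par_reduces:
  "II (CC (numeral_of (Suc n)) p \<parallel> q) \<leadsto> EE (II (p \<parallel> (copies n p \<parallel> q)))"
proof -
  have "II (CC (numeral_of (Suc n)) p \<parallel> q) \<leadsto> II ((EE p \<parallel> copies n p) \<parallel> q)"
    by (intro reduces_Unary reduces_BinaryL CC_reduces)
  \<comment> \<open>Reassociating makes the marked copy alone the left operand, as rule (6)
    requires.\<close>
  also have "\<dots> \<approx> II (EE p \<parallel> (copies n p \<parallel> q))"
    by (intro ac_Unary ac_assoc)
  also have "\<dots> \<leadsto> EE (II (p \<parallel> (copies n p \<parallel> q)))" by (rule TRS_H_reduces)
  finally show ?thesis .
qed

text \<open>Shared by both cases of \<open>encodes_chop\<close>: \<open>p\<close> and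
  \<open>p'\<close> encode the parent before and after the deletion, and the last two premises are
  the matching pair of D-rules, without and with siblings of the parent.\<close>

lemma grandparent_simulation:
  assumes p: "encodes (Node (add_mset (Node {#}) P)) p" and p': "encodes (Node P) p'"
    and single: "DD (numeral_of (Suc n)) (II p) \<leadsto> II (CC (numeral_of (Suc n)) p')"
    and par: "\<And>q. DD (numeral_of (Suc n)) (II (p \<parallel> q)) \<leadsto> II (CC (numeral_of (Suc n)) p' \<parallel> q)"
  shows "\<exists>x t'. encodes (Node (add_mset (Node (add_mset (Node {#}) P)) Q)) (II x) \<and>
      encodes (Node (replicate_mset (n + 2) (Node P) + Q)) t' \<and>
      DD (numeral_of (Suc n)) (II x) \<leadsto> EE t'"
proof (cases "Q = {#}")
  case True
  \<comment> \<open>\<open>p' \<parallel> copies n p'\<close> is \<open>copies (Suc n) p'\<close>,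
    which has the required \<open>n + 2\<close> copies.\<close>
  have "encodes (Node (replicate_mset (n + 2) (Node P))) (II (p' \<parallel> copies n p'))"
    using encodes_Node[OF encodes_forest_copies[OF p', of "Suc n"]] by simp
  moreover have "DD (numeral_of (Suc n)) (II p) \<leadsto> EE (II (p' \<parallel> copies n p'))"
    using single II_CC_reduces by (rule reduces_trans)
  moreover have "encodes (Node {#Node (add_mset (Node {#}) P)#}) (II p)"
    using p by (intro encodes_Node encodes_forest_single)
  ultimately show ?thesis using True by auto
next
  case False
  then obtain q where q: "encodes_forest Q q" using encodes_forest_exists by blast
  have "encodes (Node (replicate_mset (n + 2) (Node P) + Q)) (II (p' \<parallel> (copies n p' \<parallel> q)))"
    using encodes_Node[OF encodes_forest_add[OF p'
        encodes_forest_union[OF encodes_forest_copies[OF p', of n] q]]] by simp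
  moreover have "DD (numeral_of (Suc n)) (II (p \<parallel> q)) \<leadsto> EE (II (p' \<parallel> (copies n p' \<parallel> q)))"
    using par II_CC_par_reduces by (rule reduces_trans)
  ultimately show ?thesis using encodes_Node[OF encodes_forest_add[OF p q]] by blast
qed

text \<open>The induction follows the path from the grandparent up to the root. The encoding of
  \<open>T\<close> is kept in the form \<open>II x\<close> because rules (8) and (9) move D only
  onto a child of that form; D descends one level before the induction hypothesis, and E rises one
  level after it.\<close>

lemma inner_step_simulation:
  "inner_step n T T' \<Longrightarrow>
    \<exists>x t'. encodes T (II x) \<and> encodes T' t' \<and> DD (numeral_of (Suc n)) (II x) \<leadsto> EE t'"
proof (induction rule: inner_step.induct)
  case (1 P Q)
  show ?case
  proof (rule encodes_chop[of P])
    assume "encodes (Node (add_mset (Node {#}) P)) (II hh)" "encodes (Node P) hh"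
    \<comment> \<open>The parent becomes a leaf: rules (13) and (12).\<close>
    then show ?thesis by (rule grandparent_simulation) (rule TRS_H_reduces)+
  next
    fix x
    assume "encodes (Node (add_mset (Node {#}) P)) (II (hh \<parallel> x))" "encodes (Node P) (II x)"
    \<comment> \<open>The parent keeps children: rules (11) and (10).\<close>
    then show ?thesis by (rule grandparent_simulation) (rule TRS_H_reduces)+
  qed
next
  case (2 S S' Q)
  then obtain x s' where x: "encodes S (II x)" and s': "encodes S' s'"
    and IH: "DD (numeral_of (Suc n)) (II x) \<leadsto> EE s'" by blast
  show ?case
  proof (cases "Q = {#}")
    case True
    have "DD (numeral_of (Suc n)) (II (II x)) \<leadsto> II (DD (numeral_of (Suc n)) (II x))"
      by (rule TRS_H_reduces)
    also have "\<dots> \<leadsto> II (EE s')" using IH by (rule reduces_Unary)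
    also have "\<dots> \<leadsto> EE (II s')" by (rule TRS_H_reduces)
    finally show ?thesis
      using True encodes_Node[OF encodes_forest_single[OF x]]
        encodes_Node[OF encodes_forest_single[OF s']] by blast
  next
    case False
    then obtain q where q: "encodes_forest Q q" using encodes_forest_exists by blast
    have "DD (numeral_of (Suc n)) (II (II x \<parallel> q)) \<leadsto> II (DD (numeral_of (Suc n)) (II x) \<parallel> q)"
      by (rule TRS_H_reduces)
    also have "\<dots> \<leadsto> II (EE s' \<parallel> q)" using IH by (intro reduces_Unary reduces_BinaryL)
    also have "\<dots> \<leadsto> EE (II (s' \<parallel> q))" by (rule TRS_H_reduces)
    finally show ?thesis
      using encodes_Node[OF encodes_forest_add[OF x q]]
        encodes_Node[OF encodes_forest_add[OF s' q]] by blast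
  qed
qed

lemma battle_step_simulation:
  assumes "battle_step n T T'"
  shows "\<exists>t t'. encodes T t \<and> encodes T' t' \<and> AA (numeral_of n) t \<leadsto> AA (ss (numeral_of n)) t'"
  using assms
proof cases
  case (root P)
  show ?thesis
    \<comment> \<open>The two cases of \<open>encodes_chop\<close> are exactly rules (1) and
      (2).\<close>
    unfolding root by (rule encodes_chop[of P]) (blast intro: TRS_H_reduces)+
next
  case inner
  then obtain x t' where x: "encodes T (II x)" and t': "encodes T' t'"
    and D: "DD (numeral_of (Suc n)) (II x) \<leadsto> EE t'"
    using inner_step_simulation by blast
  \<comment> \<open>Rule (3) hands the successor of the stage to D, which is the counter that
    \<open>inner_step_simulation\<close> expects.\<close>
  have "AA (numeral_of n) (II x) \<leadsto> BB (numeral_of n) (DD (numeral_of (Suc n)) (II x))"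
    by (simp add: TRS_H_reduces)
  also have "\<dots> \<leadsto> BB (numeral_of n) (EE t')" using D by (rule reduces_BinaryR)
  also have "\<dots> \<leadsto> AA (ss (numeral_of n)) t'" by (rule TRS_H_reduces)
  finally show ?thesis using x t' by blast
qed

theorem theorem3p4:
  fixes T T' :: hydra and H H' :: trm and stage :: nat
  assumes "battle_step stage T T'"
    and "H \<in> hydra_terms" and "encodes T H"
    and "H' \<in> hydra_terms" and "encodes T' H'"
  shows "\<exists>n \<in> numerals. (AA n H, AA (ss n) H') \<in> (rstep_AC TRS_H)\<^sup>+"
proof (rule bexI)
  \<comment> \<open>The numeral of the stage is the witness, since the number of copies made depends
    on it.\<close>
  let ?n = "numeral_of stage"
  obtain t t' where t: "encodes T t" and t': "encodes T' t'"
    and sim: "AA ?n t \<leadsto> AA (ss ?n) t'"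
    using battle_step_simulation[OF assms(1)] by blast
  \<comment> \<open>The simulation runs between chosen encodings; uniqueness connects them to the
    given ones by AC steps at both ends.\<close>
  have "AA ?n H \<approx> AA ?n t"
    using assms(3) t by (intro ac_Binary ac_refl) (rule encodes_unique)
  also note sim
  also have "AA (ss ?n) t' \<approx> AA (ss ?n) H'"
    using t' assms(5) by (intro ac_Binary ac_refl) (rule encodes_unique)
  finally show "(AA ?n H, AA (ss ?n) H') \<in> (rstep_AC TRS_H)\<^sup>+"
    unfolding reduces_def .
qed (rule numeral_of_numerals)

end
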